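(* Let $X$ be a compact metric space with metric $d$. For any expansive homeomorphism $f\colon X\to X$, the following conditions are equivalent: (0) $Sen(f|_{CR(f)})=\emptyset$; (1) $CR(f)$ is a finite set; (2) every $C\in\mathcal{C}(f)$ is a finite set; (3) $CR(f)=Per(f)$.
   Context: Let $f\colon X\to X$ be a continuous map of a compact metric space $(X,d)$. Chain recurrence: for $\delta>0$, a sequence $(x_i)_{i=0}^k$ of points of $X$ with $k\ge1$ is a $\delta$-chain of $f$ if $d(f(x_i),x_{i+1})\le\delta$ for all $0\le i\le k-1$. Write $x\rightarrow y$ if for every $\delta>0$ there is a $\delta$-chain $(x_i)_{i=0}^k$ of $f$ with $x_0=x$, $x_k=y$. $CR(f)=\{x\in X\colon x\rightarrow x\}$ is the set of chain recurrent points; it is closed and $f(CR(f))=CR(f)$. On $CR(f)$, $x\leftrightarrow y$ means $x\rightarrow y$ and $y\rightarrow x$; this is an equivalence relation, its equivalence classes are called the chain components for $f$, and $\mathcal{C}(f)$ denotes the set of chain components. Sensitive points: for $a>0$, $Sen_a(f)$ is the set of $x\in X$ such that for every $\delta>0$ there is $y\in X$ with $d(x,y)\le\delta$ and $d(f^i(x),f^i(y))>a$ for some $i\ge0$; $Sen(f)=\bigcup_{a>0}Sen_a(f)$. For the restriction $f|_{CR(f)}\colon CR(f)\to CR(f)$, the definition is applied with the space $CR(f)$ in place of $X$. Periodic points: $Per(f)=\bigcup_{j\ge1}\{x\in X\colon f^j(x)=x\}$. Expansive: a homeomorphism $f\colon X\to X$ is expansive if there is $e>0$ such that for all $x,y\in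 X$, $\sup_{i\in\mathbb{Z}}d(f^i(x),f^i(y))\le e$ implies $x=y$. *)

theory Defs
  imports "HOL-Analysis.Analysis"
begin

text \<open>
  A system consists of a subset \<open>X\<close> of a metric space type, with the induced metric, and a
  function \<open>f\<close> that maps \<open>X\<close> into \<open>X\<close>; the values of \<open>f\<close> outside \<open>X\<close> play no role. Passing to
  a subsystem, such as the chain recurrent set, thus amounts to replacing \<open>X\<close> and keeping \<open>f\<close>.
\<close>

definition delta_chain ::
  "'a::metric_space set \<Rightarrow> ('a \<Rightarrow> 'a) \<Rightarrow> real \<Rightarrow> nat \<Rightarrow> (nat \<Rightarrow> 'a) \<Rightarrow> bool" where
  "delta_chain X f \<delta> k x \<longleftrightarrow>
     k \<ge> 1 \<and> (\<forall>i\<le>k. x i \<in> X) \<and> (\<forall>i<k. dist (f (x i)) (x (i + 1)) \<le> \<delta>)"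

definition chain_to :: "'a::metric_space set \<Rightarrow> ('a \<Rightarrow> 'a) \<Rightarrow> 'a \<Rightarrow> 'a \<Rightarrow> bool" where
  "chain_to X f x y \<longleftrightarrow> (\<forall>\<delta>>0. \<exists>k z. delta_chain X f \<delta> k z \<and> z 0 = x \<and> z k = y)"

definition chain_recurrent :: "'a::metric_space set \<Rightarrow> ('a \<Rightarrow> 'a) \<Rightarrow> 'a set" where
  "chain_recurrent X f = {x \<in> X. chain_to X f x x}"

definition chain_equiv :: "'a::metric_space set \<Rightarrow> ('a \<Rightarrow> 'a) \<Rightarrow> 'a rel" where
  "chain_equiv X f =
     {(x, y). x \<in> chain_recurrent X f \<and> y \<in> chain_recurrent X f \<and>
              chain_to X f x y \<and> chain_to X f y x}"

definition chain_components :: "'a::metric_space set \<Rightarrow> ('a \<Rightarrow> 'a) \<Rightarrow> 'a set set" where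
  "chain_components X f = chain_recurrent X f // chain_equiv X f"

definition sensitive_at_scale ::
  "real \<Rightarrow> 'a::metric_space set \<Rightarrow> ('a \<Rightarrow> 'a) \<Rightarrow> 'a set" where
  "sensitive_at_scale a X f =
     {x \<in> X. \<forall>\<delta>>0. \<exists>y\<in>X. dist x y \<le> \<delta> \<and> (\<exists>i. dist ((f ^^ i) x) ((f ^^ i) y) > a)}"

definition sensitive_points :: "'a::metric_space set \<Rightarrow> ('a \<Rightarrow> 'a) \<Rightarrow> 'a set" where
  "sensitive_points X f = (\<Union>a\<in>{0<..}. sensitive_at_scale a X f)"

definition periodic_points :: "'a set \<Rightarrow> ('a \<Rightarrow> 'a) \<Rightarrow> 'a set" where
  "periodic_points X f = (\<Union>j\<in>{1..}. {x \<in> X. (f ^^ j) x = x})"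

text \<open>Integer iterates of a bijection \<open>f\<close> of \<open>X\<close>; the inverse is taken relative to \<open>X\<close>.\<close>

definition int_iterate :: "'a set \<Rightarrow> ('a \<Rightarrow> 'a) \<Rightarrow> int \<Rightarrow> 'a \<Rightarrow> 'a" where
  "int_iterate X f i = (if i \<ge> 0 then f ^^ nat i else inv_into X f ^^ nat (- i))"

text \<open>The supremum is taken in the extended reals, so that it is meaningful without a
  boundedness assumption on \<open>X\<close>.\<close>

definition expansive_homeomorphism :: "'a::metric_space set \<Rightarrow> ('a \<Rightarrow> 'a) \<Rightarrow> bool" where
  "expansive_homeomorphism X f \<longleftrightarrow>
     (\<exists>g. homeomorphism X X f g) \<and>
     (\<exists>e>0. \<forall>x\<in>X. \<forall>y\<in>X.
        (SUP i. ereal (dist (int_iterate X f i x) (int_iterate X f i y))) \<le> ereal e \<longrightarrow> x = y)"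

end

theory Submission
  imports Defs
begin

text \<open>
  Let \<open>Y\<close> be the chain recurrent set. It is compact and invariant under the homeomorphism and
  its inverse, so it is again a compact expansive system. That a finite \<open>Y\<close> has no sensitive
  points and only finite components is clear. The content lies in three implications.

  No sensitive points implies finite (\<open>finite_if_not_sensitive\<close>). Without sensitivity,
  nearby points stay close for all positive times, so finitely many small balls control all
  futures. Pulling finitely many points far back in time and applying the pigeonhole principle
  to these balls shows that, if there are more points than balls, two of them stay close at all
  times, which expansivity forbids.

  Finite components implies periodic (\<open>periodic_if_finite_chain_component\<close>). A chain recurrent
  point is chain equivalent to its image, so its orbit stays in one component; an orbit of an
  injective map that stays in a finite set is periodic.

  All points periodic implies finite (\<open>finite_if_all_periodic\<close>). An infinite compact set has a
  limit point, and the points next to it must separate from it, but only after a long time. In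
  the limit this gives two points that are apart now but were close during their whole past. For
  periodic points the past determines the future, so this contradicts expansivity.

  These two statements on finiteness hold for every compact expansive system and have nothing to
  do with chains; they are applied to \<open>Y\<close>. Chains enter through the second implication and
  through the fact that \<open>Y\<close> is a compact subsystem.
\<close>

section \<open>Chains\<close>

lemma delta_chain_append:
  assumes "delta_chain X f \<delta> k u" and "delta_chain X f \<delta> l v" and "u k = v 0"
  shows "delta_chain X f \<delta> (k + l) (\<lambda>i. if i \<le> k then u i else v (i - k))"
proof -
  have "dist (f (if i \<le> k then u i else v (i - k)))
          (if i + 1 \<le> k then u (i + 1) else v (i + 1 - k)) \<le> \<delta>" if i: "i < k + l" for i
  proof -
    consider "i < k" | "i = k" | "k < i" by linarith
    then show ?thesis
    proof cases
      case 3
      then have "i + 1 - k = (i - k) + 1" "i - k < l" using i by auto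
      then show ?thesis using assms(2) 3 by (simp add: delta_chain_def)
    qed (use assms i in \<open>auto simp: delta_chain_def\<close>)
  qed
  then show ?thesis using assms by (auto simp: delta_chain_def)
qed

lemma chain_to_trans:
  assumes "chain_to X f x y" and "chain_to X f y z"
  shows "chain_to X f x z"
  unfolding chain_to_def
proof (intro allI impI)
  fix \<delta> :: real assume "\<delta> > 0"
  then obtain k u l v where u: "delta_chain X f \<delta> k u" "u 0 = x" "u k = y"
    and v: "delta_chain X f \<delta> l v" "v 0 = y" "v l = z"
    using assms unfolding chain_to_def by metis
  have "l \<ge> 1" using v by (simp add: delta_chain_def)
  then show "\<exists>k z'. delta_chain X f \<delta> k z' \<and> z' 0 = x \<and> z' k = z"
    using delta_chain_append[OF u(1) v(1)] u v
    by (intro exI[of _ "k + l"] exI[of _ "\<lambda>i. if i \<le> k then u i else v (i - k)"]) auto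
qed

lemma chain_to_image:
  assumes "x \<in> X" and "f x \<in> X"
  shows "chain_to X f x (f x)"
  unfolding chain_to_def delta_chain_def
  using assms by (intro allI impI exI[of _ 1] exI[of _ "\<lambda>i. if i = 0 then x else f x"]) auto

text \<open>Uniform continuity makes chains stable under moving their points. Closedness of the chain
  recurrent set and its invariance both come from this: one moves the end points.\<close>

lemma delta_chain_perturb:
  assumes "compact X" and "continuous_on X f" and "\<delta> > 0"
  obtains \<eta> where "\<eta> > 0"
    and "\<And>k u v. delta_chain X f \<eta> k u \<Longrightarrow> (\<And>i. i \<le> k \<Longrightarrow> v i \<in> X \<and> dist (u i) (v i) \<le> \<eta>)
           \<Longrightarrow> delta_chain X f \<delta> k v"
proof -
  have "uniformly_continuous_on X f"
    using assms compact_uniformly_continuous by blast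
  then obtain \<eta>' where \<eta>': "\<eta>' > 0"
    "\<And>x y. x \<in> X \<Longrightarrow> y \<in> X \<Longrightarrow> dist x y < \<eta>' \<Longrightarrow> dist (f x) (f y) < \<delta> / 3"
    unfolding uniformly_continuous_on_def using \<open>\<delta> > 0\<close>
    by (metis zero_less_divide_iff zero_less_numeral)
  define \<eta> where "\<eta> = min (\<eta>' / 2) (\<delta> / 3)"
  have \<eta>: "\<eta> > 0" "\<eta> < \<eta>'" "\<eta> \<le> \<delta> / 3" using \<eta>' \<open>\<delta> > 0\<close> by (auto simp: \<eta>_def)
  have "delta_chain X f \<delta> k v"
    if u: "delta_chain X f \<eta> k u" and v: "\<And>i. i \<le> k \<Longrightarrow> v i \<in> X \<and> dist (u i) (v i) \<le> \<eta>" for k u v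
  proof -
    have "dist (f (v i)) (v (i + 1)) \<le> \<delta>" if "i < k" for i
    proof -
      have 1: "u i \<in> X" "dist (f (u i)) (u (i + 1)) \<le> \<eta>"
        using u that by (auto simp: delta_chain_def)
      have 2: "v i \<in> X" "dist (u i) (v i) \<le> \<eta>" "dist (u (i + 1)) (v (i + 1)) \<le> \<eta>"
        using v[of i] v[of "i + 1"] that by auto
      have "dist (f (u i)) (f (v i)) < \<delta> / 3"
        using \<eta>'(2) 1 2 \<eta> by force
      then show ?thesis
        using 1 2 \<eta> dist_triangle[of "f (v i)" "v (i + 1)" "f (u i)"]
          dist_triangle[of "f (u i)" "v (i + 1)" "u (i + 1)"]
        by (simp add: dist_commute)
    qed
    then show ?thesis using u v by (auto simp: delta_chain_def)
  qed
  then show ?thesis using that \<eta>(1) by blast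
qed

section \<open>The chain recurrent set of a homeomorphism\<close>

lemma compact_chain_recurrent:
  assumes "compact X" and "continuous_on X f"
  shows "compact (chain_recurrent X f)"
proof -
  have "x \<in> chain_recurrent X f" if x: "x \<in> X" "x \<in> closure (chain_recurrent X f)" for x
  proof -
    have "\<exists>k z. delta_chain X f \<delta> k z \<and> z 0 = x \<and> z k = x" if "\<delta> > 0" for \<delta>
    proof -
      obtain \<eta> where "\<eta> > 0" and \<eta>:
        "\<And>k u v. delta_chain X f \<eta> k u \<Longrightarrow> (\<And>i. i \<le> k \<Longrightarrow> v i \<in> X \<and> dist (u i) (v i) \<le> \<eta>)
           \<Longrightarrow> delta_chain X f \<delta> k v"
        using delta_chain_perturb[OF assms \<open>\<delta> > 0\<close>] by metis
      obtain y where y: "y \<in> chain_recurrent X f" "dist y x < \<eta>"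
        using x \<open>\<eta> > 0\<close> by (meson closure_approachable)
      obtain k u where u: "delta_chain X f \<eta> k u" "u 0 = y" "u k = y"
        using y \<open>\<eta> > 0\<close> by (auto simp: chain_recurrent_def chain_to_def)
      have "delta_chain X f \<delta> k (u(0 := x, k := x))"
        using u y x \<open>\<eta> > 0\<close> by (intro \<eta>[OF u(1)]) (auto simp: delta_chain_def)
      then show ?thesis by (intro exI[of _ k] exI[of _ "u(0 := x, k := x)"]) auto
    qed
    then show ?thesis using x by (auto simp: chain_recurrent_def chain_to_def)
  qed
  moreover have "closure (chain_recurrent X f) \<subseteq> X"
    using compact_imp_closed[OF assms(1)] by (intro closure_minimal) (auto simp: chain_recurrent_def)
  ultimately have "closed (chain_recurrent X f)"
    by (metis closure_subset_eq subsetD subsetI)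
  then have "compact (X \<inter> chain_recurrent X f)" by (rule compact_Int_closed[OF assms(1)])
  moreover have "X \<inter> chain_recurrent X f = chain_recurrent X f"
    by (auto simp: chain_recurrent_def)
  ultimately show ?thesis by simp
qed

text \<open>A chain from \<open>x\<close> back to \<open>x\<close> that is long enough passes near \<open>f x\<close> at time 1, so
  its tail may be started at \<open>f x\<close> instead. Running twice around the loop makes the tail
  nonempty.\<close>

lemma chain_to_from_image:
  assumes "compact X" and "continuous_on X f" and "f ` X \<subseteq> X" and "x \<in> chain_recurrent X f"
  shows "chain_to X f (f x) x"
  unfolding chain_to_def
proof (intro allI impI)
  fix \<delta> :: real assume "\<delta> > 0"
  then obtain \<eta> where "\<eta> > 0" and \<eta>:
    "\<And>k u v. delta_chain X f \<eta> k u \<Longrightarrow> (\<And>i. i \<le> k \<Longrightarrow> v i \<in> X \<and> dist (u i) (v i) \<le> \<eta>)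
       \<Longrightarrow> delta_chain X f \<delta> k v"
    using delta_chain_perturb[OF assms(1,2)] by metis
  have x: "x \<in> X" "f x \<in> X" using assms by (auto simp: chain_recurrent_def)
  obtain k u where u: "delta_chain X f \<eta> k u" "u 0 = x" "u k = x"
    using assms(4) \<open>\<eta> > 0\<close> by (auto simp: chain_recurrent_def chain_to_def)
  define w where "w i = (if i \<le> k then u i else u (i - k))" for i
  have w: "delta_chain X f \<eta> (k + k) w" "w 0 = x" "w (k + k) = x"
    using delta_chain_append[OF u(1,1)] u by (auto simp: w_def[abs_def])
  have k: "k \<ge> 1" using u by (simp add: delta_chain_def)
  define l where "l = k + k - 1"
  have l: "l \<ge> 1" "Suc l = k + k" using k by (auto simp: l_def)
  have wX: "\<And>i. i \<le> Suc l \<Longrightarrow> w i \<in> X"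
    and wd: "\<And>i. i < Suc l \<Longrightarrow> dist (f (w i)) (w (Suc i)) \<le> \<eta>"
    using w(1) l(2) by (auto simp: delta_chain_def)
  have "delta_chain X f \<eta> l (\<lambda>i. w (Suc i))"
    using wX wd l(1) by (auto simp: delta_chain_def)
  then have "delta_chain X f \<delta> l (\<lambda>i. if i = 0 then f x else w (Suc i))"
    using x wX wd[of 0] w(2) \<open>\<eta> > 0\<close> by (intro \<eta>) (auto simp: dist_commute)
  then show "\<exists>k z. delta_chain X f \<delta> k z \<and> z 0 = f x \<and> z k = x"
    using w(3) l by (intro exI[of _ l] exI[of _ "\<lambda>i. if i = 0 then f x else w (Suc i)"]) auto
qed

lemma chain_equiv_image:
  assumes "compact X" and "continuous_on X f" and "f ` X \<subseteq> X" and "x \<in> chain_recurrent X f"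
  shows "(x, f x) \<in> chain_equiv X f"
proof -
  have x: "x \<in> X" "f x \<in> X" using assms by (auto simp: chain_recurrent_def)
  show ?thesis
    using chain_to_image[of x X f] chain_to_from_image[OF assms] x assms(4)
      chain_to_trans[of X f "f x" x "f x"]
    by (auto simp: chain_equiv_def chain_recurrent_def)
qed

text \<open>Reversing a chain of \<open>f\<close> yields a chain of its inverse. Hence the chain recurrent set
  does not see the direction of time, and forward invariance under the inverse is backward
  invariance under \<open>f\<close>.\<close>

lemma chain_recurrent_subset_inverse:
  assumes "compact X" and hom: "homeomorphism X X f g"
  shows "chain_recurrent X f \<subseteq> chain_recurrent X g"
proof
  fix x assume x: "x \<in> chain_recurrent X f"
  have "\<exists>k z. delta_chain X g \<delta> k z \<and> z 0 = x \<and> z k = x" if "\<delta> > 0" for \<delta>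
  proof -
    have "uniformly_continuous_on X g"
      using assms compact_uniformly_continuous homeomorphism_cont2 by blast
    then obtain \<eta> where \<eta>: "\<eta> > 0"
      "\<And>x y. x \<in> X \<Longrightarrow> y \<in> X \<Longrightarrow> dist x y < \<eta> \<Longrightarrow> dist (g x) (g y) < \<delta>"
      unfolding uniformly_continuous_on_def using \<open>\<delta> > 0\<close> by metis
    obtain k u where u: "delta_chain X f (\<eta> / 2) k u" "u 0 = x" "u k = x"
      using x half_gt_zero[OF \<eta>(1)]
      unfolding chain_recurrent_def chain_to_def mem_Collect_eq by meson
    have "dist (g (u (k - i))) (u (k - (i + 1))) \<le> \<delta>" if "i < k" for i
    proof -
      define j where "j = k - (i + 1)"
      have j: "j < k" "k - i = j + 1" using that by (auto simp: j_def)
      have "u j \<in> X" "u (j + 1) \<in> X" "dist (f (u j)) (u (j + 1)) < \<eta>"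
        using u(1) j \<eta>(1) by (auto simp: delta_chain_def)
      then have "dist (g (f (u j))) (g (u (j + 1))) < \<delta>"
        using \<eta>(2) hom by (metis homeomorphism_image1 imageI)
      then show ?thesis
        using hom \<open>u j \<in> X\<close> j(2) by (simp add: homeomorphism_apply1 dist_commute j_def)
    qed
    then have "delta_chain X g \<delta> k (\<lambda>i. u (k - i))"
      using u by (auto simp: delta_chain_def)
    then show ?thesis
      using u by (intro exI[of _ k] exI[of _ "\<lambda>i. u (k - i)"]) auto
  qed
  then show "x \<in> chain_recurrent X g" using x by (auto simp: chain_recurrent_def chain_to_def)
qed

lemma homeomorphism_chain_recurrent:
  assumes "compact X" and hom: "homeomorphism X X f g"
  shows "homeomorphism (chain_recurrent X f) (chain_recurrent X f) f g"
proof -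
  have hom': "homeomorphism X X g f" using hom by (rule homeomorphism_symD)
  have eq: "chain_recurrent X g = chain_recurrent X f"
    using chain_recurrent_subset_inverse[OF assms(1)] hom hom' by blast
  have inv: "h x \<in> chain_recurrent X h"
    if "homeomorphism X X h h'" "x \<in> chain_recurrent X h" for h h' x
    using chain_equiv_image[OF assms(1), of h x] that
    by (auto simp: homeomorphism_def chain_equiv_def)
  have sub: "chain_recurrent X f \<subseteq> X" by (auto simp: chain_recurrent_def)
  have fg: "f ` chain_recurrent X f \<subseteq> chain_recurrent X f"
      "g ` chain_recurrent X f \<subseteq> chain_recurrent X f"
    using inv[OF hom] inv[OF hom'] eq by auto
  have gf: "g (f x) = x" "f (g x) = x" if "x \<in> chain_recurrent X f" for x
    using that sub hom by (auto simp: homeomorphism_def)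
  show ?thesis
    using fg gf hom sub by (intro homeomorphismI) (auto simp: homeomorphism_def intro: continuous_on_subset)
qed

lemma periodic_points_subset_chain_recurrent:
  assumes "f ` X \<subseteq> X"
  shows "periodic_points X f \<subseteq> chain_recurrent X f"
proof
  fix x assume "x \<in> periodic_points X f"
  then obtain j where j: "j \<ge> 1" "x \<in> X" "(f ^^ j) x = x" by (auto simp: periodic_points_def)
  have "(f ^^ i) x \<in> X" for i using assms j(2) by (induction i) auto
  then have "delta_chain X f \<delta> j (\<lambda>i. (f ^^ i) x)" if "\<delta> > 0" for \<delta>
    using j that by (auto simp: delta_chain_def)
  then show "x \<in> chain_recurrent X f"
    using j by (auto simp: chain_recurrent_def chain_to_def
        intro!: exI[of _ j] exI[of _ "\<lambda>i. (f ^^ i) x"])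
qed

text \<open>The whole forward orbit of a chain recurrent point lies in its chain component. If that
  component is finite then the orbit repeats, and injectivity turns eventual periodicity into
  periodicity.\<close>

lemma periodic_if_finite_chain_component:
  assumes "compact X" and hom: "homeomorphism X X f g" and x: "x \<in> chain_recurrent X f"
    and fin: "finite (chain_equiv X f `` {x})"
  shows "x \<in> periodic_points X f"
proof -
  have xX: "x \<in> X" using x by (simp add: chain_recurrent_def)
  have f: "continuous_on X f" "f ` X = X" "inj_on f X"
    using hom by (auto simp: homeomorphism_def intro: inj_on_inverseI)
  have orb: "(x, (f ^^ i) x) \<in> chain_equiv X f" for i
  proof (induction i)
    case 0
    show ?case using x by (simp add: chain_equiv_def chain_recurrent_def)
  next
    case (Suc i)
    then have "(f ^^ i) x \<in> chain_recurrent X f" by (simp add: chain_equiv_def)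
    then have "((f ^^ i) x, (f ^^ Suc i) x) \<in> chain_equiv X f"
      using chain_equiv_image[OF assms(1) f(1)] f(2) by simp
    with Suc show ?case unfolding chain_equiv_def using chain_to_trans by blast
  qed
  then have "finite (range (\<lambda>i. (f ^^ i) x))"
    by (intro finite_subset[OF _ fin]) auto
  then have "\<not> inj (\<lambda>i. (f ^^ i) x)"
    using finite_imageD infinite_UNIV_nat by blast
  then obtain a b where ab: "a < b" "(f ^^ a) x = (f ^^ b) x"
    unfolding inj_def by (metis linorder_neqE_nat)
  have inX: "(f ^^ i) x \<in> X" for i using f(2) xX by (induction i) auto
  have "(f ^^ i) x = (f ^^ (i + (b - a))) x \<Longrightarrow> x = (f ^^ (b - a)) x" for i
  proof (induction i)
    case (Suc i)
    then show ?case using f(3) inX by (auto dest: inj_onD)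
  qed simp
  from this[of a] ab have "(f ^^ (b - a)) x = x" by simp
  then show ?thesis using ab xX by (auto simp: periodic_points_def intro!: bexI[of _ "b - a"])
qed

section \<open>Compact expansive systems\<close>

text \<open>Naming the inverse \<open>g\<close> makes the assumptions symmetric under reversal of time.\<close>

locale compact_expansive =
  fixes X :: "'a::metric_space set" and f g :: "'a \<Rightarrow> 'a" and e :: real
  assumes compact: "compact X"
    and hom: "homeomorphism X X f g"
    and e_pos: "e > 0"
    and expansive: "\<lbrakk>x \<in> X; y \<in> X; \<And>n. dist ((f ^^ n) x) ((f ^^ n) y) \<le> e;
      \<And>n. dist ((g ^^ n) x) ((g ^^ n) y) \<le> e\<rbrakk> \<Longrightarrow> x = y"
begin

lemma reversed: "compact_expansive X g f e"
  using compact e_pos expansive homeomorphism_symD[OF hom] by unfold_locales auto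

lemma restrict_chain_recurrent: "compact_expansive (chain_recurrent X f) f g e"
proof
  show "compact (chain_recurrent X f)"
    using compact hom by (auto simp: homeomorphism_def intro: compact_chain_recurrent)
  show "homeomorphism (chain_recurrent X f) (chain_recurrent X f) f g"
    using compact hom by (rule homeomorphism_chain_recurrent)
qed (use e_pos expansive in \<open>auto simp: chain_recurrent_def\<close>)

lemma iterate_in: "x \<in> X \<Longrightarrow> (f ^^ n) x \<in> X" "x \<in> X \<Longrightarrow> (g ^^ n) x \<in> X"
  using hom by (induction n) (auto simp: homeomorphism_def)

lemma continuous_iterate: "continuous_on X (f ^^ n)"
proof (induction n)
  case (Suc n)
  have "continuous_on ((f ^^ n) ` X) f"
    using hom iterate_in by (auto simp: homeomorphism_def intro: continuous_on_subset)
  with continuous_on_compose[OF Suc] show ?case by simp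
qed auto

lemma forward_backward: "(f ^^ n) ((g ^^ n) x) = x" if "x \<in> X"
proof (induction n)
  case (Suc n)
  have "(f ^^ Suc n) ((g ^^ Suc n) x) = (f ^^ n) (f (g ((g ^^ n) x)))"
    by (simp add: funpow_swap1)
  also have "f (g ((g ^^ n) x)) = (g ^^ n) x"
    using hom iterate_in(2)[OF that] by (auto simp: homeomorphism_def)
  finally show ?case using Suc by simp
qed simp

lemma forward_backward_add: "(f ^^ (i + n)) ((g ^^ n) x) = (f ^^ i) x" if "x \<in> X"
  using forward_backward[OF that] by (simp add: funpow_add)

lemma forward_backward_diff: "(f ^^ (n - j)) ((g ^^ n) x) = (g ^^ j) x"
  if "x \<in> X" and "j \<le> n"
proof -
  have "(g ^^ n) x = (g ^^ (n - j)) ((g ^^ j) x)"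
    using that by (simp flip: funpow_add[THEN fun_cong, unfolded comp_def])
  then show ?thesis using forward_backward iterate_in that by simp
qed

text \<open>If \<open>m\<close> balls cover \<open>X\<close> and the points in each ball have \<open>e\<close>-close futures, then
  among any \<open>m + 1\<close> points two lie in the same ball when they are pulled back by time
  \<open>n\<close>. As \<open>n\<close> grows, some pair recurs forever, and that pair is \<open>e\<close>-close at all
  times, past and future.\<close>

lemma finite_if_not_sensitive:
  assumes "sensitive_points X f = {}"
  shows "finite X"
proof (rule ccontr)
  assume "infinite X"
  have "\<exists>r>0. \<forall>y\<in>X. dist x y \<le> r \<longrightarrow> (\<forall>i. dist ((f ^^ i) x) ((f ^^ i) y) \<le> e / 2)"
    if "x \<in> X" for x
  proof -
    have "x \<notin> sensitive_at_scale (e / 2) X f"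
      using assms e_pos by (auto simp: sensitive_points_def)
    with that show ?thesis
      by (auto simp: sensitive_at_scale_def not_less)
  qed
  then obtain r where r: "\<And>x. x \<in> X \<Longrightarrow> r x > 0"
    "\<And>x y i. x \<in> X \<Longrightarrow> y \<in> X \<Longrightarrow> dist x y \<le> r x \<Longrightarrow> dist ((f ^^ i) x) ((f ^^ i) y) \<le> e / 2"
    by metis
  have "X \<subseteq> (\<Union>c\<in>X. ball c (r c))" using r(1) by force
  then obtain D where D: "D \<subseteq> X" "finite D" "X \<subseteq> (\<Union>c\<in>D. ball c (r c))"
    by (rule compactE_image[OF compact, rotated]) auto
  obtain P where P: "P \<subseteq> X" "finite P" "card P = Suc (card D)"
    using infinite_arbitrarily_large[OF \<open>infinite X\<close>] by metis
  have "\<forall>x\<in>X. \<exists>c. c \<in> D \<and> x \<in> ball c (r c)" using D(3) by blast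
  then obtain c where c: "\<And>x. x \<in> X \<Longrightarrow> c x \<in> D"
    "\<And>x. x \<in> X \<Longrightarrow> x \<in> ball (c x) (r (c x))"
    by metis
  define Q where "Q = P \<times> P - Id"
  have "\<exists>z\<in>Q. c ((g ^^ n) (fst z)) = c ((g ^^ n) (snd z))" for n
  proof -
    have "(\<lambda>p. c ((g ^^ n) p)) ` P \<subseteq> D" using c(1) iterate_in(2) P(1) by auto
    then have "card ((\<lambda>p. c ((g ^^ n) p)) ` P) < card P"
      using card_mono[OF D(2)] P(3) by (metis less_Suc_eq_le)
    then have "\<not> inj_on (\<lambda>p. c ((g ^^ n) p)) P" by (rule pigeonhole)
    then obtain p q where "p \<in> P" "q \<in> P" "p \<noteq> q" "c ((g ^^ n) p) = c ((g ^^ n) q)"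
      by (auto simp: inj_on_def)
    then show ?thesis by (intro bexI[of _ "(p, q)"]) (auto simp: Q_def)
  qed
  then have "\<exists>z. \<forall>n. z n \<in> Q \<and> c ((g ^^ n) (fst (z n))) = c ((g ^^ n) (snd (z n)))"
    by (intro choice) blast
  then obtain z where z: "\<And>n. z n \<in> Q"
    "\<And>n. c ((g ^^ n) (fst (z n))) = c ((g ^^ n) (snd (z n)))"
    by blast
  have "finite Q" using P(2) by (simp add: Q_def)
  then have "finite (range z)" using z(1) by (meson finite_subset image_subsetI)
  then obtain N where "infinite {n. z n = z N}"
    using pigeonhole_infinite[of UNIV z] by auto
  then have recur: "\<exists>n\<ge>j. z n = z N" for j
    by (metis (mono_tags) infinite_nat_iff_unbounded_le mem_Collect_eq)
  define p q where "p = fst (z N)" and "q = snd (z N)"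
  have "(p, q) \<in> Q" using z(1)[of N] by (simp add: p_def q_def)
  then have pq: "p \<in> X" "q \<in> X" "p \<noteq> q" using P(1) by (auto simp: Q_def)
  have close: "dist ((f ^^ i) ((g ^^ n) p)) ((f ^^ i) ((g ^^ n) q)) \<le> e" if "z n = z N" for n i
  proof -
    define a where "a = c ((g ^^ n) p)"
    have "a = c ((g ^^ n) q)" using z(2)[of n] that by (simp add: a_def p_def q_def)
    then have "a \<in> X" "dist a ((g ^^ n) p) \<le> r a" "dist a ((g ^^ n) q) \<le> r a"
      using c[OF iterate_in(2)[OF pq(1), of n]] c(2)[OF iterate_in(2)[OF pq(2), of n]] D(1)
      by (auto simp flip: a_def)
    then have "dist ((f ^^ i) a) ((f ^^ i) ((g ^^ n) p)) \<le> e / 2"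
      "dist ((f ^^ i) a) ((f ^^ i) ((g ^^ n) q)) \<le> e / 2"
      using r(2) iterate_in pq by auto
    then show ?thesis
      using dist_triangle[of "(f ^^ i) ((g ^^ n) p)" "(f ^^ i) ((g ^^ n) q)" "(f ^^ i) a"]
      by (simp add: dist_commute)
  qed
  have "p = q"
  proof (rule expansive[OF pq(1,2)])
    fix i
    show "dist ((f ^^ i) p) ((f ^^ i) q) \<le> e"
      using close[of N "i + N"] forward_backward_add pq by simp
    obtain n where "n \<ge> i" "z n = z N" using recur by blast
    then show "dist ((g ^^ i) p) ((g ^^ i) q) \<le> e"
      using close[of n "n - i"] forward_backward_diff pq by simp
  qed
  then show False using pq by simp
qed

text \<open>Periodic points see their whole orbit at positive times, so for them closeness in the
  future alone is enough.\<close>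

lemma periodic_eqI:
  assumes "x \<in> X" and "y \<in> X" and "(f ^^ j) x = x" and "(f ^^ k) y = y" and "j \<ge> 1" and "k \<ge> 1"
    and close: "\<And>i. i \<ge> 1 \<Longrightarrow> dist ((f ^^ i) x) ((f ^^ i) y) \<le> e"
  shows "x = y"
proof -
  have period: "(f ^^ (j * k * n)) x = x" "(f ^^ (j * k * n)) y = y" for n
  proof -
    have "(f ^^ (j * i)) x = x" "(f ^^ (k * i)) y = y" for i
      using assms(3,4) by (induction i) (simp_all add: funpow_add)
    from this(1)[of "k * n"] this(2)[of "j * n"]
    show "(f ^^ (j * k * n)) x = x" "(f ^^ (j * k * n)) y = y" by (simp_all add: ac_simps)
  qed
  have ge: "j * k * n \<ge> n" for n using assms(5,6) by (cases "j * k") auto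
  show ?thesis
  proof (rule expansive[OF assms(1,2)])
    fix i
    show "dist ((f ^^ i) x) ((f ^^ i) y) \<le> e"
    proof (cases "i = 0")
      case True
      then show ?thesis using close[of "j * k"] period[of 1] ge[of 1] by simp
    qed (use close in simp)
    \<comment> \<open>the \<open>i\<close>-th backward iterate is the forward iterate at a multiple of the common
      period minus \<open>i\<close>; the extra \<open>+ 1\<close> keeps that time positive\<close>
    define n where "n = j * k * (i + 1)"
    have n: "n - i \<ge> 1" "n - i + i = n" using ge[of "i + 1"] unfolding n_def by linarith+
    have "(g ^^ i) x = (f ^^ (n - i)) x" "(g ^^ i) y = (f ^^ (n - i)) y"
    proof -
      interpret rev: compact_expansive X g f e by (rule reversed)
      have "(g ^^ i) ((f ^^ i) ((f ^^ (n - i)) u)) = (f ^^ (n - i)) u" if "u \<in> X" for u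
        using rev.forward_backward iterate_in that by simp
      moreover have "(f ^^ i) ((f ^^ (n - i)) u) = (f ^^ n) u" for u
        using n(2) by (metis add.commute comp_apply funpow_add)
      ultimately show "(g ^^ i) x = (f ^^ (n - i)) x" "(g ^^ i) y = (f ^^ (n - i)) y"
        using period[of "i + 1"] assms(1,2) unfolding n_def by metis+
    qed
    then show "dist ((g ^^ i) x) ((g ^^ i) y) \<le> e" using close n(1) by simp
  qed
qed

text \<open>Near a limit point \<open>p\<close>, a periodic point other than \<open>p\<close> shadows the orbit of
  \<open>p\<close> for a long time, but by expansivity it has to separate from it by more than \<open>e\<close>
  eventually. A limit of the two
  positions at the moment of separation is a pair of points at distance at least \<open>e\<close> whose
  pasts are \<open>e\<close>-close. Both are periodic, so they coincide: a contradiction.\<close>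

lemma finite_if_all_periodic:
  assumes per: "X \<subseteq> periodic_points X f"
  shows "finite X"
proof (rule ccontr)
  assume "infinite X"
  then obtain p where p: "p \<in> X" "p islimpt X"
    using compact by (metis compact_eq_Bolzano_Weierstrass order_refl)
  have periodE: "\<exists>j\<ge>1. (f ^^ j) x = x" if "x \<in> X" for x
    using per that by (auto simp: periodic_points_def)
  interpret rev: compact_expansive X g f e by (rule reversed)
  have "\<exists>x i. x \<in> X \<and> i \<ge> n \<and> dist ((f ^^ i) x) ((f ^^ i) p) > e
      \<and> (\<forall>j<i. dist ((f ^^ j) x) ((f ^^ j) p) \<le> e)" for n
  proof -
    have "\<forall>\<^sub>F x in at p within X. dist ((f ^^ i) x) ((f ^^ i) p) < e" for i
      using continuous_iterate[of i] p(1) e_pos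
      by (auto simp: continuous_on_def intro: tendstoD)
    then have "\<forall>\<^sub>F x in at p within X. \<forall>i\<in>{..<n}. dist ((f ^^ i) x) ((f ^^ i) p) < e"
      by (intro eventually_ball_finite) auto
    then obtain d where d: "d > 0"
      "\<And>x. x \<in> X \<Longrightarrow> x \<noteq> p \<Longrightarrow> dist x p < d \<Longrightarrow> \<forall>i<n. dist ((f ^^ i) x) ((f ^^ i) p) < e"
      by (auto simp: eventually_at)
    obtain x where x: "x \<in> X" "x \<noteq> p" "dist x p < d"
      using p(2) d(1) by (auto simp: islimpt_approachable)
    have "\<exists>i. dist ((f ^^ i) x) ((f ^^ i) p) > e"
      using periodic_eqI[OF x(1) p(1)] periodE[OF x(1)] periodE[OF p(1)] x(2)
      by (meson not_less)
    then obtain i where i: "dist ((f ^^ i) x) ((f ^^ i) p) > e"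
      "\<forall>j<i. dist ((f ^^ j) x) ((f ^^ j) p) \<le> e"
      using exists_least_iff[of "\<lambda>i. dist ((f ^^ i) x) ((f ^^ i) p) > e"] by (meson not_less)
    have "i \<ge> n" using d(2)[OF x] i(1) by (meson not_less order.asym)
    with i x show ?thesis by blast
  qed
  then obtain x t where xt: "\<And>n. x n \<in> X" "\<And>n. t n \<ge> n"
    "\<And>n. dist ((f ^^ t n) (x n)) ((f ^^ t n) p) > e"
    "\<And>n j. j < t n \<Longrightarrow> dist ((f ^^ j) (x n)) ((f ^^ j) p) \<le> e"
    by metis
  define w where "w n = ((f ^^ t n) (x n), (f ^^ t n) p)" for n
  have "w n \<in> X \<times> X" for n using iterate_in xt(1) p(1) by (auto simp: w_def)
  moreover have "seq_compact (X \<times> X)"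
    using compact by (simp add: compact_Times flip: compact_eq_seq_compact_metric)
  ultimately obtain l s where l: "l \<in> X \<times> X" "strict_mono s" "(w \<circ> s) \<longlonglongrightarrow> l"
    unfolding seq_compact_def by metis
  obtain y q where yq: "l = (y, q)" by fastforce
  have y: "y \<in> X" "q \<in> X" using l(1) yq by auto
  have ly: "(\<lambda>n. (f ^^ t (s n)) (x (s n))) \<longlonglongrightarrow> y" and lq: "(\<lambda>n. (f ^^ t (s n)) p) \<longlonglongrightarrow> q"
    using tendsto_fst[OF l(3)] tendsto_snd[OF l(3)] by (auto simp: w_def yq comp_def)
  have "e \<le> dist y q"
    using xt(3) by (intro LIMSEQ_le_const[OF tendsto_dist[OF ly lq]]) (auto intro: less_imp_le)
  moreover have "y = q"
  proof -
    have close: "dist ((g ^^ i) y) ((g ^^ i) q) \<le> e" if "i \<ge> 1" for i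
    proof -
      have lim: "(\<lambda>n. (g ^^ i) (v n)) \<longlonglongrightarrow> (g ^^ i) a"
        if "v \<longlonglongrightarrow> a" "a \<in> X" "\<And>n. v n \<in> X" for v a
        using continuous_on_tendsto_compose[OF rev.continuous_iterate that(1,2)] that(3) by simp
      have "(\<lambda>n. dist ((g ^^ i) ((f ^^ t (s n)) (x (s n)))) ((g ^^ i) ((f ^^ t (s n)) p)))
          \<longlonglongrightarrow> dist ((g ^^ i) y) ((g ^^ i) q)"
        by (intro tendsto_dist lim ly lq y iterate_in xt(1) p(1))
      moreover have
        "dist ((g ^^ i) ((f ^^ t (s n)) (x (s n)))) ((g ^^ i) ((f ^^ t (s n)) p)) \<le> e" if "n \<ge> i" for n
      proof -
        have le: "i \<le> t (s n)" using that seq_suble[OF l(2), of n] xt(2)[of "s n"] by linarith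
        have "(g ^^ i) ((f ^^ t (s n)) u) = (f ^^ (t (s n) - i)) u" if "u \<in> X" for u
          using rev.forward_backward_diff[OF that diff_le_self[of "t (s n)" i]] le by simp
        then show ?thesis using xt(1) p(1) xt(4)[of "t (s n) - i" "s n"] le \<open>i \<ge> 1\<close> by simp
      qed
      ultimately show ?thesis by (intro LIMSEQ_le_const2) auto
    qed
    obtain j k where "j \<ge> 1" "(f ^^ j) y = y" "k \<ge> 1" "(f ^^ k) q = q"
      using periodE y by metis
    moreover from this have "(g ^^ j) y = y" "(g ^^ k) q = q"
      using rev.forward_backward[OF y(1), of j] rev.forward_backward[OF y(2), of k] by auto
    ultimately show ?thesis using rev.periodic_eqI[OF y] close by blast
  qed
  ultimately show False using e_pos by simp
qed

end

lemma compact_expansiveI: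
  assumes "compact X" and "expansive_homeomorphism X f"
  obtains g e where "compact_expansive X f g e"
proof -
  obtain h e where h: "homeomorphism X X f h" and "e > 0"
    and e: "\<And>x y. x \<in> X \<Longrightarrow> y \<in> X \<Longrightarrow>
      (SUP i. ereal (dist (int_iterate X f i x) (int_iterate X f i y))) \<le> ereal e \<Longrightarrow> x = y"
    using assms(2) unfolding expansive_homeomorphism_def by blast
  define g where "g = inv_into X f"
  have "inj_on f X" using h by (auto simp: homeomorphism_def intro: inj_on_inverseI)
  then have "g x = h x" if "x \<in> X" for x
    using h that by (metis g_def homeomorphism_def imageI inv_into_f_f)
  then have "homeomorphism X X f g"
    using homeomorphism_cong[OF h refl refl] by simp
  moreover have "x = y" if "x \<in> X" "y \<in> X"
    and fw: "\<And>n. dist ((f ^^ n) x) ((f ^^ n) y) \<le> e"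
    and bw: "\<And>n. dist ((g ^^ n) x) ((g ^^ n) y) \<le> e" for x y
    using that by (intro e SUP_least) (auto simp: int_iterate_def g_def)
  ultimately have "compact_expansive X f g e"
    unfolding compact_expansive_def using assms(1) \<open>e > 0\<close> by blast
  then show ?thesis by (rule that)
qed

lemma not_sensitive_if_finite:
  assumes "finite X"
  shows "sensitive_points X f = {}"
proof -
  have "x \<notin> sensitive_at_scale a X f" if "a > 0" for a x
  proof
    assume x: "x \<in> sensitive_at_scale a X f"
    obtain d where d: "d > 0" "\<forall>y\<in>X. y \<noteq> x \<longrightarrow> d \<le> dist x y"
      using finite_set_avoid[OF assms] by blast
    then obtain y i where "y \<in> X" "dist x y \<le> d / 2" "dist ((f ^^ i) x) ((f ^^ i) y) > a"
      using x by (force simp: sensitive_at_scale_def dest!: spec[of _ "d / 2"])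
    then show False using d \<open>a > 0\<close> by (cases "y = x") force+
  qed
  then show ?thesis by (auto simp: sensitive_points_def)
qed

section \<open>The equivalence\<close>

theorem theorem1p1:
  fixes X :: "'a::metric_space set" and f :: "'a \<Rightarrow> 'a"
  assumes "compact X"
    and "expansive_homeomorphism X f"
  shows "(sensitive_points (chain_recurrent X f) f = {} \<longleftrightarrow> finite (chain_recurrent X f)) \<and>
         (finite (chain_recurrent X f) \<longleftrightarrow> (\<forall>C\<in>chain_components X f. finite C)) \<and>
         ((\<forall>C\<in>chain_components X f. finite C) \<longleftrightarrow> chain_recurrent X f = periodic_points X f)"
proof -
  obtain g e where "compact_expansive X f g e" using compact_expansiveI[OF assms] .
  then interpret compact_expansive X f g e .
  interpret CR: compact_expansive "chain_recurrent X f" f g e by (rule restrict_chain_recurrent)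
  have "sensitive_points (chain_recurrent X f) f = {} \<longleftrightarrow> finite (chain_recurrent X f)"
    using CR.finite_if_not_sensitive not_sensitive_if_finite by blast
  moreover have "\<forall>C\<in>chain_components X f. finite C" if "finite (chain_recurrent X f)"
    using that by (auto simp: chain_components_def chain_equiv_def quotient_def intro: finite_subset)
  moreover have "chain_recurrent X f = periodic_points X f" if "\<forall>C\<in>chain_components X f. finite C"
  proof
    show "chain_recurrent X f \<subseteq> periodic_points X f"
      using periodic_if_finite_chain_component[OF compact hom] that
      by (auto simp: chain_components_def intro: quotientI)
    show "periodic_points X f \<subseteq> chain_recurrent X f"
      using hom by (intro periodic_points_subset_chain_recurrent) (auto simp: homeomorphism_def)
  qed
  moreover have "finite (chain_recurrent X f)" if "chain_recurrent X f = periodic_points X f"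
    using that by (intro CR.finite_if_all_periodic) (auto simp: periodic_points_def)
  ultimately show ?thesis by blast
qed

end
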